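(* Let $E$ be an effect algebra and let $S\subseteq E$. If $S\cup\{1\}$ admits a compatibility support mapping, then $S$ is coexistent.
   Context: An effect algebra is a partial algebra $(E;\oplus,0,1)$ with a partial binary operation $\oplus$ and constants $0,1$ such that: (E1) if $a\oplus b$ is defined, then $b\oplus a$ is defined and $a\oplus b=b\oplus a$; (E2) if $a\oplus b$ and $(a\oplus b)\oplus c$ are defined, then $b\oplus c$ and $a\oplus(b\oplus c)$ are defined and $(a\oplus b)\oplus c=a\oplus(b\oplus c)$; (E3) for every $a\in E$ there is a unique $a'\in E$ with $a\oplus a'=1$; (E4) if $a\oplus 1$ exists, then $a=0$. One writes $a\le b$ iff there is $c\in E$ with $a\oplus c=b$; this is a partial order with least element $0$ and greatest element $1$. The element $b\ominus a$ is defined iff $a\le b$, and then it is the unique element with $a\oplus(b\ominus a)=b$. For a set $S$, $\mathrm{Fin}(S)$ denotes the set of all finite subsets of $S$ (including $\emptyset$). Let $T\subseteq E$ with $1\in T$. A compatibility support mapping for $T$ is a mapping $[\![\cdot,\cdot]\!]:\mathrm{Fin}(T)\times\mathrm{Fin}(T)\to E$ such that for all $U,V,V_1,V_2\in\mathrm{Fin}(T)$ and $c\in T$: (a) if $V_1\subseteq V_2$ then $[\![U,V_1]\!]\le[\![U,V_2]\!]$; (b) $[\![U,V]\!]\le[\![U,\{1\}]\!]$; (c) $[\![U,\emptyset]\!]=0$; (d) $[\![\emptyset,\{c\}]\!]=c$; (e) if $c\notin U\cup V$, then $[\![U\cup\{c\},\{1\}]\!]\ominus[\![U\cup\{c\},V]\!]=[\![U,V\cup\{c\}]\!]\ominus[\![U,V]\!]$.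 "$T$ admits a compatibility support mapping" means that such a mapping exists. An observable is a mapping $\alpha:B\to E$ from a Boolean algebra $B$ such that $\alpha(0)=0$, $\alpha(1)=1$ and, for all $x,y\in B$ with $x\wedge y=0$, $\alpha(x\vee y)=\alpha(x)\oplus\alpha(y)$ (in particular the right-hand side is defined). A subset $S\subseteq E$ is coexistent if there are a Boolean algebra $B$ and an observable $\alpha:B\to E$ with $S\subseteq\alpha(B)$. *)

theory Defs
  imports "HOL-Algebra.Lattice"
begin

text \<open>
  The partial operation of an effect algebra on the carrier \<open>E\<close> is a function into the option
  type: \<open>a \<oplus> b = Some c\<close> says that the sum of \<open>a\<close> and \<open>b\<close> is defined and equals \<open>c\<close>.  Only its
  values on elements of \<open>E\<close> matter.
\<close>

locale effect_algebra =
  fixes E :: "'a set"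
    and oplus :: "'a \<Rightarrow> 'a \<Rightarrow> 'a option"  (infixl "\<oplus>" 65)
    and zero :: 'a  ("\<zero>")
    and one :: 'a  ("\<one>")
  assumes zero_closed: "\<zero> \<in> E"
    and one_closed: "\<one> \<in> E"
    and oplus_closed: "\<lbrakk>a \<in> E; b \<in> E; a \<oplus> b = Some c\<rbrakk> \<Longrightarrow> c \<in> E"
    and E1: "\<lbrakk>a \<in> E; b \<in> E; a \<oplus> b = Some c\<rbrakk> \<Longrightarrow> b \<oplus> a = Some c"
    and E2: "\<lbrakk>a \<in> E; b \<in> E; c \<in> E; a \<oplus> b = Some d; d \<oplus> c = Some e\<rbrakk>
               \<Longrightarrow> \<exists>f. b \<oplus> c = Some f \<and> a \<oplus> f = Some e"
    and E3: "a \<in> E \<Longrightarrow> \<exists>!a'. a' \<in> E \<and> a \<oplus> a' = Some \<one>"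
    and E4: "\<lbrakk>a \<in> E; a \<oplus> \<one> = Some b\<rbrakk> \<Longrightarrow> a = \<zero>"
begin

definition le :: "'a \<Rightarrow> 'a \<Rightarrow> bool"  (infix "\<preceq>" 50)
  where "a \<preceq> b \<longleftrightarrow> (\<exists>c\<in>E. a \<oplus> c = Some b)"

definition ominus :: "'a \<Rightarrow> 'a \<Rightarrow> 'a option"  (infixl "\<ominus>" 65)
  where "b \<ominus> a = (if a \<preceq> b then Some (THE c. c \<in> E \<and> a \<oplus> c = Some b) else None)"

end

text \<open>
  Both sides of \<open>csm_diff\<close> are partial differences.  They are defined by \<open>csm_le_one\<close> and
  \<open>csm_mono\<close>, so the equation never holds as \<open>None = None\<close>.
\<close>

locale compatibility_support_mapping = effect_algebra +
  fixes T :: "'a set"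
    and f :: "'a set \<Rightarrow> 'a set \<Rightarrow> 'a"  ("\<lbrakk>_,/ _\<rbrakk>")
  assumes T_subset: "T \<subseteq> E"
    and one_in_T: "\<one> \<in> T"
    and csm_closed: "\<And>U V. U \<in> Fpow T \<Longrightarrow> V \<in> Fpow T \<Longrightarrow> \<lbrakk>U, V\<rbrakk> \<in> E"
    and csm_mono: "\<And>U V1 V2. U \<in> Fpow T \<Longrightarrow> V1 \<in> Fpow T \<Longrightarrow> V2 \<in> Fpow T \<Longrightarrow> V1 \<subseteq> V2
                     \<Longrightarrow> \<lbrakk>U, V1\<rbrakk> \<preceq> \<lbrakk>U, V2\<rbrakk>"
    and csm_le_one: "\<And>U V. U \<in> Fpow T \<Longrightarrow> V \<in> Fpow T \<Longrightarrow> \<lbrakk>U, V\<rbrakk> \<preceq> \<lbrakk>U, {\<one>}\<rbrakk>"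
    and csm_empty: "\<And>U. U \<in> Fpow T \<Longrightarrow> \<lbrakk>U, {}\<rbrakk> = \<zero>"
    and csm_singleton: "\<And>c. c \<in> T \<Longrightarrow> \<lbrakk>{}, {c}\<rbrakk> = c"
    and csm_diff: "\<And>U V c. U \<in> Fpow T \<Longrightarrow> V \<in> Fpow T \<Longrightarrow> c \<in> T \<Longrightarrow> c \<notin> U \<union> V
                     \<Longrightarrow> \<lbrakk>U \<union> {c}, {\<one>}\<rbrakk> \<ominus> \<lbrakk>U \<union> {c}, V\<rbrakk> = \<lbrakk>U, V \<union> {c}\<rbrakk> \<ominus> \<lbrakk>U, V\<rbrakk>"

locale boolean_lattice = bounded_lattice L for L (structure) +
  assumes meet_join_distrib:
      "\<lbrakk>x \<in> carrier L; y \<in> carrier L; z \<in> carrier L\<rbrakk>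
         \<Longrightarrow> x \<sqinter> (y \<squnion> z) = (x \<sqinter> y) \<squnion> (x \<sqinter> z)"
    and complement_exists:
      "x \<in> carrier L \<Longrightarrow> \<exists>y\<in>carrier L. x \<sqinter> y = \<bottom> \<and> x \<squnion> y = \<top>"

context effect_algebra
begin

definition admits_compatibility_support_mapping :: "'a set \<Rightarrow> bool"
  where "admits_compatibility_support_mapping T \<longleftrightarrow>
           (\<exists>f. compatibility_support_mapping E (\<oplus>) \<zero> \<one> T f)"

definition observable :: "'b gorder \<Rightarrow> ('b \<Rightarrow> 'a) \<Rightarrow> bool"
  where "observable B \<alpha> \<longleftrightarrow>
           boolean_lattice B \<and> \<alpha> \<in> carrier B \<rightarrow> E \<and>
           \<alpha> \<bottom>\<^bsub>B\<^esub> = \<zero> \<and> \<alpha> \<top>\<^bsub>B\<^esub> = \<one> \<and>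
           (\<forall>x\<in>carrier B. \<forall>y\<in>carrier B.
              x \<sqinter>\<^bsub>B\<^esub> y = \<bottom>\<^bsub>B\<^esub> \<longrightarrow> \<alpha> x \<oplus> \<alpha> y = Some (\<alpha> (x \<squnion>\<^bsub>B\<^esub> y)))"

text \<open>
  HOL has no quantification over types, so the type \<open>'b\<close> in which the carrier of the Boolean
  algebra lives is a parameter.  Coexistence over any type implies coexistence over
  \<open>'a set set\<close>: given an observable covering \<open>S\<close>, choose a preimage of each element of \<open>S\<close> and
  restrict to the Boolean subalgebra they generate.  That subalgebra has at most
  \<open>2 ^ 2 ^ card S\<close> elements if \<open>S\<close> is finite and at most as many as \<open>S\<close> otherwise, hence it is
  isomorphic to a Boolean algebra carried by a subset of \<open>'a set set\<close>.
\<close>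

definition coexistent :: "'b itself \<Rightarrow> 'a set \<Rightarrow> bool"
  where "coexistent (_ :: 'b itself) S \<longleftrightarrow>
           S \<subseteq> E \<and> (\<exists>(B :: 'b gorder) \<alpha>. observable B \<alpha> \<and> S \<subseteq> \<alpha> ` carrier B)"

end

end

theory Submission
  imports Defs "HOL-Algebra.FiniteProduct"
begin

text \<open>
  Read \<open>\<lbrakk>U, V\<rbrakk>\<close> as the value of an observable, still to be found, at \<open>\<And>U \<and> \<Or>V\<close>.  Then the value
  at \<open>\<And>U \<and> \<not> \<Or>V\<close> has to be \<open>\<lbrakk>U, {\<one>}\<rbrakk> \<ominus> \<lbrakk>U, V\<rbrakk>\<close>, called \<open>atom U V\<close> below.  The axioms of a
  compatibility support mapping provide these differences and make them fit together: the atom for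
  \<open>U = V = {}\<close> is \<open>\<one>\<close>, the atom for \<open>U = {c}\<close> and \<open>V = {}\<close> is \<open>c\<close>, and every atom is the
  orthogonal sum of the two atoms obtained by adding a new element \<open>c\<close> to \<open>U\<close> or to \<open>V\<close>
  (\<open>atom_split\<close>, which is where \<open>csm_diff\<close> enters).

  The Boolean algebra is the free one on \<open>T\<close>, realised as the field of those sets \<open>W\<close> of subsets
  of the whole type for which membership of \<open>x\<close> in \<open>W\<close> depends on \<open>x \<inter> F\<close> only, for some finite
  \<open>F \<subseteq> T\<close>.  The observable maps \<open>W\<close> to the orthogonal sum of \<open>atom U (F - U)\<close> over the
  \<open>U \<subseteq> F\<close> that lie in \<open>W\<close>.  By \<open>atom_split\<close> enlarging \<open>F\<close> does not change the sum
  (\<open>weight_insert\<close>); hence the value depends on \<open>W\<close> alone, the sum over all \<open>U \<subseteq> F\<close> equals the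
  atom for \<open>U = V = {}\<close>, which is \<open>\<one>\<close>, and every partial sum is therefore defined.  Additivity is
  the splitting of a sum over a disjoint union, and \<open>c \<in> T\<close> is the image of \<open>{x. c \<in> x}\<close>.

  Finite orthogonal sums need no separate theory: with a value \<open>None\<close> for undefined sums that
  absorbs everything, the partial operation becomes a total commutative monoid, and orthogonal
  sums are finite products in it.
\<close>

section \<open>Fields of sets as Boolean lattices\<close>

definition inclusion_order :: "'b set set \<Rightarrow> 'b set gorder"
  where "inclusion_order C = \<lparr>carrier = C, eq = (=), le = (\<subseteq>)\<rparr>"

lemma inclusion_order_simps [simp]:
  "carrier (inclusion_order C) = C"
  "x \<sqsubseteq>\<^bsub>inclusion_order C\<^esub> y \<longleftrightarrow> x \<subseteq> y"
  "x .=\<^bsub>inclusion_order C\<^esub> y \<longleftrightarrow> x = y"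
  by (simp_all add: inclusion_order_def)

locale field_of_sets =
  fixes \<Omega> :: "'b set" and C :: "'b set set"
  assumes subset_space: "C \<subseteq> Pow \<Omega>"
    and empty_mem: "{} \<in> C"
    and compl_mem: "x \<in> C \<Longrightarrow> \<Omega> - x \<in> C"
    and Un_mem: "x \<in> C \<Longrightarrow> y \<in> C \<Longrightarrow> x \<union> y \<in> C"
begin

abbreviation L where "L \<equiv> inclusion_order C"

lemma space_mem: "\<Omega> \<in> C"
  using compl_mem[OF empty_mem] by simp

lemma Int_mem: "x \<inter> y \<in> C" if "x \<in> C" "y \<in> C"
proof -
  have "x \<inter> y = \<Omega> - ((\<Omega> - x) \<union> (\<Omega> - y))"
    using that subset_space by blast
  then show ?thesis
    using that by (metis Un_mem compl_mem)
qed

lemma least_Upper_iff: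
  assumes "x \<in> C" "y \<in> C"
  shows "least L s (Upper L {x, y}) \<longleftrightarrow> s = x \<union> y"
proof
  assume "least L s (Upper L {x, y})"
  then have "x \<subseteq> s" "y \<subseteq> s" and "\<And>u. u \<in> C \<Longrightarrow> x \<subseteq> u \<Longrightarrow> y \<subseteq> u \<Longrightarrow> s \<subseteq> u"
    using assms by (simp_all add: least_def Upper_def)
  from this(1,2) this(3)[OF Un_mem[OF assms]] show "s = x \<union> y"
    by blast
qed (use assms Un_mem in \<open>simp add: least_def Upper_def\<close>)

lemma greatest_Lower_iff:
  assumes "x \<in> C" "y \<in> C"
  shows "greatest L s (Lower L {x, y}) \<longleftrightarrow> s = x \<inter> y"
proof
  assume "greatest L s (Lower L {x, y})"
  then have "s \<subseteq> x" "s \<subseteq> y" and "\<And>u. u \<in> C \<Longrightarrow> u \<subseteq> x \<Longrightarrow> u \<subseteq> y \<Longrightarrow> u \<subseteq> s"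
    using assms by (simp_all add: greatest_def Lower_def)
  from this(1,2) this(3)[OF Int_mem[OF assms]] show "s = x \<inter> y"
    by blast
qed (use assms Int_mem in \<open>simp add: greatest_def Lower_def\<close>)

lemma join_eq: "x \<in> C \<Longrightarrow> y \<in> C \<Longrightarrow> x \<squnion>\<^bsub>L\<^esub> y = x \<union> y"
  by (simp add: join_def sup_def least_Upper_iff)

lemma meet_eq: "x \<in> C \<Longrightarrow> y \<in> C \<Longrightarrow> x \<sqinter>\<^bsub>L\<^esub> y = x \<inter> y"
  by (simp add: meet_def inf_def greatest_Lower_iff)

lemma least_carrier_iff: "least L s C \<longleftrightarrow> s = {}"
  using empty_mem by (auto simp: least_def)

lemma greatest_carrier_iff: "greatest L s C \<longleftrightarrow> s = \<Omega>"
  using space_mem subset_space by (auto simp: greatest_def)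

lemma inclusion_bottom: "\<bottom>\<^bsub>L\<^esub> = {}"
  by (simp add: bottom_def least_carrier_iff)

lemma inclusion_top: "\<top>\<^bsub>L\<^esub> = \<Omega>"
  by (simp add: top_def greatest_carrier_iff)

lemma boolean_lattice_inclusion_order: "boolean_lattice L"
proof -
  interpret partial_order L
    by standard (auto simp: fun_eq_iff)
  interpret bounded_lattice L
  proof
    show "\<exists>s. least L s (Upper L {x, y})" if "x \<in> carrier L" "y \<in> carrier L" for x y
      using that by (simp add: least_Upper_iff)
    show "\<exists>s. greatest L s (Lower L {x, y})" if "x \<in> carrier L" "y \<in> carrier L" for x y
      using that by (simp add: greatest_Lower_iff)
  qed (simp_all add: least_carrier_iff greatest_carrier_iff)
  show ?thesis
  proof
    show "\<exists>y\<in>carrier L. x \<sqinter>\<^bsub>L\<^esub> y = \<bottom>\<^bsub>L\<^esub> \<and> x \<squnion>\<^bsub>L\<^esub> y = \<top>\<^bsub>L\<^esub>" if "x \<in> carrier L" for x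
    proof (intro bexI[of _ "\<Omega> - x"] conjI)
      show "x \<sqinter>\<^bsub>L\<^esub> (\<Omega> - x) = \<bottom>\<^bsub>L\<^esub>"
        using that compl_mem by (simp add: meet_eq inclusion_bottom)
      show "x \<squnion>\<^bsub>L\<^esub> (\<Omega> - x) = \<top>\<^bsub>L\<^esub>"
        using that compl_mem subset_space by (simp add: join_eq inclusion_top) blast
    qed (use that compl_mem in simp)
  qed (simp add: join_eq meet_eq Un_mem Int_mem Int_Un_distrib)
qed

end

section \<open>Orthogonal sums as products in a commutative monoid\<close>

text \<open>
  The strong associativity law of an effect algebra, in which definedness of one bracketing implies
  definedness of the other, is what makes this structure a monoid.
\<close>

definition partial_sum_monoid ::
    "'a set \<Rightarrow> ('a \<Rightarrow> 'a \<Rightarrow> 'a option) \<Rightarrow> 'a \<Rightarrow> 'a option monoid"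
  where "partial_sum_monoid E f z =
    \<lparr>carrier = insert None (Some ` E),
     mult = (\<lambda>x y. Option.bind x (\<lambda>a. Option.bind y (f a))),
     one = Some z\<rparr>"

context effect_algebra
begin

lemma oplus_eq_commute: "a \<in> E \<Longrightarrow> b \<in> E \<Longrightarrow> a \<oplus> b = b \<oplus> a"
  by (metis E1 option.exhaust)

lemma orthosupplement_unique:
  "\<lbrakk>a \<in> E; b \<in> E; c \<in> E; a \<oplus> b = Some \<one>; a \<oplus> c = Some \<one>\<rbrakk> \<Longrightarrow> b = c"
  using E3 by blast

lemma zero_oplus: assumes a: "a \<in> E" shows "\<zero> \<oplus> a = Some a"
proof -
  obtain i where i: "i \<in> E" "\<one> \<oplus> i = Some \<one>"
    using E3[OF one_closed] by blast
  then have "i = \<zero>"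
    using E4[OF i(1) E1[OF one_closed i]] by simp
  with i have one_zero: "\<one> \<oplus> \<zero> = Some \<one>" by simp
  obtain b where b: "b \<in> E" "a \<oplus> b = Some \<one>"
    using E3[OF a] by blast
  then have ba: "b \<oplus> a = Some \<one>"
    using E1[OF a] by simp
  from E2[OF b(1) a zero_closed ba one_zero]
  obtain f where f: "a \<oplus> \<zero> = Some f" "b \<oplus> f = Some \<one>" by blast
  then have "f = a"
    using orthosupplement_unique[OF b(1) _ a f(2) ba] oplus_closed[OF a zero_closed f(1)] by simp
  then show ?thesis
    using E1[OF a zero_closed f(1)] by simp
qed

lemma cancel:
  assumes E: "a \<in> E" "b \<in> E" "c \<in> E" and ab: "a \<oplus> b = Some e" and ac: "a \<oplus> c = Some e"
  shows "b = c"
proof -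
  have e: "e \<in> E" using oplus_closed[OF E(1,2) ab] .
  obtain e' where e': "e' \<in> E" "e \<oplus> e' = Some \<one>"
    using E3[OF e] by blast
  \<comment> \<open>Both \<open>b\<close> and \<open>c\<close> are orthosupplements of \<open>a \<oplus> e'\<close>.\<close>
  obtain f where f: "a \<oplus> e' = Some f" "b \<oplus> f = Some \<one>"
    using E2[OF E(2,1) e'(1) E1[OF E(1,2) ab] e'(2)] by blast
  have cf: "c \<oplus> f = Some \<one>"
    using E2[OF E(3,1) e'(1) E1[OF E(1,3) ac] e'(2)] f(1) by simp
  have "f \<in> E"
    using oplus_closed[OF E(1) e'(1) f(1)] .
  then show ?thesis
    using orthosupplement_unique E(2,3) E1[OF E(2) _ f(2)] E1[OF E(3) _ cf] by blast
qed

text \<open>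
  Cancellation makes the definite description in \<open>ominus\<close> well defined, so that differences can be
  computed by solving \<open>a \<oplus> c = b\<close>.
\<close>

lemma ominus_eq_Some_iff:
  assumes "a \<in> E" "b \<in> E"
  shows "b \<ominus> a = Some c \<longleftrightarrow> c \<in> E \<and> a \<oplus> c = Some b"
proof (cases "a \<preceq> b")
  case True
  then obtain d where d: "d \<in> E" "a \<oplus> d = Some b" by (auto simp: le_def)
  have unique: "x \<in> E \<and> a \<oplus> x = Some b \<longleftrightarrow> x = d" for x
    using cancel[OF assms(1) _ d(1) _ d(2)] d by blast
  show ?thesis
    using True by (auto simp: ominus_def unique)
qed (auto simp: ominus_def le_def)

abbreviation M where "M \<equiv> partial_sum_monoid E (\<oplus>) \<zero>"

lemma M_simps [simp]:
  "carrier M = insert None (Some ` E)"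
  "None \<otimes>\<^bsub>M\<^esub> y = None"
  "x \<otimes>\<^bsub>M\<^esub> None = None"
  "Some a \<otimes>\<^bsub>M\<^esub> Some b = a \<oplus> b"
  "\<one>\<^bsub>M\<^esub> = Some \<zero>"
  by (simp_all add: partial_sum_monoid_def bind_eq_None_conv)

lemma Some_mult_assoc:
  assumes E: "a \<in> E" "b \<in> E" "c \<in> E"
  shows "Some a \<otimes>\<^bsub>M\<^esub> Some b \<otimes>\<^bsub>M\<^esub> Some c = Some a \<otimes>\<^bsub>M\<^esub> (Some b \<otimes>\<^bsub>M\<^esub> Some c)"
proof -
  have assoc_if_defined: "Some x \<otimes>\<^bsub>M\<^esub> (Some y \<otimes>\<^bsub>M\<^esub> Some z) = Some e"
    if xyz: "x \<in> E" "y \<in> E" "z \<in> E"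
      and e: "Some x \<otimes>\<^bsub>M\<^esub> Some y \<otimes>\<^bsub>M\<^esub> Some z = Some e" for x y z e
  proof -
    obtain d where "x \<oplus> y = Some d" "d \<oplus> z = Some e"
      using e by (cases "x \<oplus> y") auto
    with E2[OF xyz] show ?thesis by fastforce
  qed
  have comm: "Some x \<otimes>\<^bsub>M\<^esub> y = y \<otimes>\<^bsub>M\<^esub> Some x" if "x \<in> E" "y \<in> carrier M" for x y
    using that oplus_eq_commute by auto
  have closed: "Some x \<otimes>\<^bsub>M\<^esub> Some y \<in> carrier M" if "x \<in> E" "y \<in> E" for x y
    using oplus_closed[OF that] by (cases "x \<oplus> y") simp_all
  have bc: "Some c \<otimes>\<^bsub>M\<^esub> Some b = Some b \<otimes>\<^bsub>M\<^esub> Some c"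
    and ab: "Some b \<otimes>\<^bsub>M\<^esub> Some a = Some a \<otimes>\<^bsub>M\<^esub> Some b"
    using oplus_eq_commute E by auto
  \<comment> \<open>Commutativity turns the reverse direction into the same statement for \<open>c, b, a\<close>.\<close>
  have "Some c \<otimes>\<^bsub>M\<^esub> Some b \<otimes>\<^bsub>M\<^esub> Some a = Some a \<otimes>\<^bsub>M\<^esub> (Some b \<otimes>\<^bsub>M\<^esub> Some c)"
    unfolding bc by (rule comm[OF E(1) closed[OF E(2,3)], symmetric])
  moreover have "Some c \<otimes>\<^bsub>M\<^esub> (Some b \<otimes>\<^bsub>M\<^esub> Some a) = Some a \<otimes>\<^bsub>M\<^esub> Some b \<otimes>\<^bsub>M\<^esub> Some c"
    unfolding ab by (rule comm[OF E(3) closed[OF E(1,2)]])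
  ultimately show ?thesis
    using assoc_if_defined[OF E] assoc_if_defined[OF E(3,2,1)] by (metis option.exhaust)
qed

sublocale M: comm_monoid M
proof (rule comm_monoidI)
  fix x y z
  assume x: "x \<in> carrier M" and y: "y \<in> carrier M"
  show "x \<otimes>\<^bsub>M\<^esub> y \<in> carrier M"
  proof (cases "x \<otimes>\<^bsub>M\<^esub> y")
    case (Some e)
    with x y obtain a b where "a \<in> E" "b \<in> E" "a \<oplus> b = Some e"
      by auto
    with Some show ?thesis by (simp add: oplus_closed[of a b])
  qed simp
  show "x \<otimes>\<^bsub>M\<^esub> y = y \<otimes>\<^bsub>M\<^esub> x"
    using x y oplus_eq_commute by auto
  assume z: "z \<in> carrier M"
  show "x \<otimes>\<^bsub>M\<^esub> y \<otimes>\<^bsub>M\<^esub> z = x \<otimes>\<^bsub>M\<^esub> (y \<otimes>\<^bsub>M\<^esub> z)"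
  proof (cases "x = None \<or> y = None \<or> z = None")
    case False
    with x y z show ?thesis using Some_mult_assoc by (auto simp del: M_simps(4))
  qed auto
qed (auto simp: zero_closed zero_oplus)

end

section \<open>The observable\<close>

context compatibility_support_mapping
begin

definition atom :: "'a set \<Rightarrow> 'a set \<Rightarrow> 'a option"
  where "atom U V = \<lbrakk>U, {\<one>}\<rbrakk> \<ominus> \<lbrakk>U, V\<rbrakk>"

lemma one_singleton_Fpow: "{\<one>} \<in> Fpow T"
  using one_in_T by (simp add: Fpow_def)

lemma atom_closed:
  assumes "U \<in> Fpow T" "V \<in> Fpow T"
  shows "atom U V \<in> Some ` E"
proof -
  obtain c where "c \<in> E" "\<lbrakk>U, V\<rbrakk> \<oplus> c = Some \<lbrakk>U, {\<one>}\<rbrakk>"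
    using csm_le_one[OF assms] by (auto simp: le_def)
  then show ?thesis
    using ominus_eq_Some_iff assms csm_closed one_singleton_Fpow unfolding atom_def by blast
qed

lemma atom_empty_empty: "atom {} {} = Some \<one>"
proof -
  have "{} \<in> Fpow T" by (simp add: Fpow_def)
  then show ?thesis
    using csm_empty csm_singleton one_in_T one_closed zero_closed zero_oplus
    by (simp add: atom_def ominus_eq_Some_iff)
qed

text \<open>
  At \<open>U = V = {}\<close> the axiom \<open>csm_diff\<close> turns the atom into \<open>\<lbrakk>{}, {c}\<rbrakk> \<ominus> \<lbrakk>{}, {}\<rbrakk> = c \<ominus> \<zero>\<close>.
\<close>

lemma atom_singleton_empty: "atom {c} {} = Some c" if "c \<in> T"
proof -
  have "{} \<in> Fpow T" by (simp add: Fpow_def)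
  then have "atom {c} {} = \<lbrakk>{}, {c}\<rbrakk> \<ominus> \<lbrakk>{}, {}\<rbrakk>"
    using csm_diff[of "{}" "{}" c] that by (simp add: atom_def)
  also have "\<dots> = Some c"
    using csm_empty csm_singleton that T_subset zero_closed zero_oplus \<open>{} \<in> Fpow T\<close>
    by (auto simp: ominus_eq_Some_iff)
  finally show ?thesis .
qed

text \<open>
  With \<open>p = \<lbrakk>U, V\<rbrakk>\<close>, \<open>q = \<lbrakk>U, V \<union> {c}\<rbrakk>\<close> and \<open>r = \<lbrakk>U, {\<one>}\<rbrakk>\<close> the claim is
  \<open>r \<ominus> p = (q \<ominus> p) \<oplus> (r \<ominus> q)\<close>, since \<open>csm_diff\<close> identifies \<open>q \<ominus> p\<close> with \<open>atom (U \<union> {c}) V\<close>.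
\<close>

lemma atom_split:
  assumes U: "U \<in> Fpow T" and V: "V \<in> Fpow T" and c: "c \<in> T" "c \<notin> U \<union> V"
  shows "atom U V = atom (insert c U) V \<otimes>\<^bsub>M\<^esub> atom U (insert c V)"
proof -
  have Vc: "insert c V \<in> Fpow T" using V c by (simp add: Fpow_def)
  note closed = csm_closed[OF U V] csm_closed[OF U Vc] csm_closed[OF U one_singleton_Fpow]
  obtain x where x: "x \<in> E" "\<lbrakk>U, V\<rbrakk> \<oplus> x = Some \<lbrakk>U, insert c V\<rbrakk>"
    using csm_mono[OF U V Vc] by (auto simp: le_def)
  then have "atom (insert c U) V = Some x"
    using csm_diff[OF U V c] closed by (simp add: atom_def ominus_eq_Some_iff)
  moreover obtain y where y: "y \<in> E" "\<lbrakk>U, insert c V\<rbrakk> \<oplus> y = Some \<lbrakk>U, {\<one>}\<rbrakk>"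
    using csm_le_one[OF U Vc] by (auto simp: le_def)
  moreover from this have "atom U (insert c V) = Some y"
    using closed by (simp add: atom_def ominus_eq_Some_iff)
  moreover obtain z where "x \<oplus> y = Some z" "\<lbrakk>U, V\<rbrakk> \<oplus> z = Some \<lbrakk>U, {\<one>}\<rbrakk>"
    using E2 x y closed by blast
  moreover from this have "atom U V = Some z"
    using closed oplus_closed[OF x(1) y(1)] by (simp add: atom_def ominus_eq_Some_iff)
  ultimately show ?thesis by simp
qed

definition supports :: "'a set \<Rightarrow> 'a set set \<Rightarrow> bool"
  where "supports F W \<longleftrightarrow> F \<in> Fpow T \<and> (\<forall>x. x \<inter> F \<in> W \<longleftrightarrow> x \<in> W)"

definition cylinders :: "'a set set set"
  where "cylinders = {W. \<exists>F. supports F W}"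

text \<open>
  The product in the monoid is the orthogonal sum of the atoms over \<open>F\<close> that lie below \<open>W\<close>;
  the value is \<open>None\<close> if the sum is undefined.
\<close>

definition weight :: "'a set \<Rightarrow> 'a set set \<Rightarrow> 'a option"
  where "weight F W = finprod M (\<lambda>U. atom U (F - U)) (Pow F \<inter> W)"

text \<open>
  The choice of the support is immaterial by \<open>weight_eq\<close>, and the weight is never \<open>None\<close> by
  \<open>weight_observable_map\<close>.
\<close>

definition observable_map :: "'a set set \<Rightarrow> 'a"
  where "observable_map W = the (weight (SOME F. supports F W) W)"

lemma supports_Fpow: "supports F W \<Longrightarrow> F \<in> Fpow T"
  by (simp add: supports_def)

lemma supports_Int_iff: "supports F W \<Longrightarrow> x \<inter> F \<in> W \<longleftrightarrow> x \<in> W"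
  by (simp add: supports_def)

lemma supports_mono:
  assumes F: "supports F W" and "F \<subseteq> G" "G \<in> Fpow T"
  shows "supports G W"
proof -
  have "x \<inter> G \<in> W \<longleftrightarrow> x \<in> W" for x
  proof -
    have "x \<inter> G \<inter> F = x \<inter> F" using \<open>F \<subseteq> G\<close> by blast
    then show ?thesis
      using supports_Int_iff[OF F, of x] supports_Int_iff[OF F, of "x \<inter> G"] by simp
  qed
  with assms(3) show ?thesis by (simp add: supports_def)
qed

lemma supports_Un: "supports F W \<Longrightarrow> supports F X \<Longrightarrow> supports F (W \<union> X)"
  by (simp add: supports_def)

lemma supports_Compl: "supports F W \<Longrightarrow> supports F (- W)"
  by (simp add: supports_def)

lemma Un_Fpow: "F \<in> Fpow T \<Longrightarrow> G \<in> Fpow T \<Longrightarrow> F \<union> G \<in> Fpow T"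
  by (simp add: Fpow_def)

sublocale cyl: field_of_sets UNIV cylinders
proof
  show "{} \<in> cylinders"
    by (auto simp: cylinders_def supports_def Fpow_def)
  show "UNIV - x \<in> cylinders" if "x \<in> cylinders" for x
    using that supports_Compl by (fastforce simp: cylinders_def Compl_eq_Diff_UNIV)
  fix x y
  assume "x \<in> cylinders" "y \<in> cylinders"
  then obtain F G where FG: "supports F x" "supports G y"
    by (auto simp: cylinders_def)
  then have "F \<union> G \<in> Fpow T"
    by (intro Un_Fpow supports_Fpow)
  with FG have "supports (F \<union> G) (x \<union> y)"
    by (meson supports_Un supports_mono sup_ge1 sup_ge2)
  then show "x \<union> y \<in> cylinders"
    by (auto simp: cylinders_def)
qed simp

lemma atom_mem_carrier:
  assumes "F \<in> Fpow T" "U \<subseteq> F"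
  shows "atom U (F - U) \<in> carrier M"
proof -
  have "U \<in> Fpow T" "F - U \<in> Fpow T"
    using assms by (auto simp: Fpow_def intro: finite_subset)
  from atom_closed[OF this] show ?thesis by simp
qed

lemma weight_Un:
  assumes "F \<in> Fpow T" "W \<inter> X = {}"
  shows "weight F (W \<union> X) = weight F W \<otimes>\<^bsub>M\<^esub> weight F X"
proof -
  have "finite (Pow F)" using assms by (simp add: Fpow_def)
  moreover have "Pow F \<inter> (W \<union> X) = (Pow F \<inter> W) \<union> (Pow F \<inter> X)" by blast
  ultimately show ?thesis
    unfolding weight_def using assms
    by (simp only:) (rule M.finprod_Un_disjoint; auto intro!: atom_mem_carrier simp del: M_simps)
qed

text \<open>
  The sets \<open>U\<close> and \<open>U \<union> {c}\<close> with \<open>U \<subseteq> F\<close> are either both in \<open>W\<close> or both outside, and their two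
  atoms over \<open>F \<union> {c}\<close> add up to the atom of \<open>U\<close> over \<open>F\<close>.
\<close>

lemma weight_insert:
  assumes F: "supports F W" and c: "c \<in> T" "c \<notin> F"
  shows "weight (insert c F) W = weight F W"
proof -
  let ?A = "Pow F \<inter> W"
  let ?d = "\<lambda>U. atom U (insert c F - U)"
  have Fin: "F \<in> Fpow T" using F by (rule supports_Fpow)
  then have G: "insert c F \<in> Fpow T" using c by (simp add: Fpow_def)
  have fin: "finite ?A" using Fin by (simp add: Fpow_def)
  have "Pow (insert c F) \<inter> W = insert c ` ?A \<union> ?A"
  proof -
    have "insert c U \<in> W \<longleftrightarrow> U \<in> W" if "U \<subseteq> F" for U
    proof -
      have "insert c U \<inter> F = U \<inter> F" using c by blast
      then show ?thesis
        using supports_Int_iff[OF F, of U] supports_Int_iff[OF F, of "insert c U"] by simp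
    qed
    then show ?thesis by (auto simp: Pow_insert)
  qed
  then have "weight (insert c F) W = finprod M ?d (insert c ` ?A \<union> ?A)"
    by (simp add: weight_def)
  also have "\<dots> = finprod M ?d (insert c ` ?A) \<otimes>\<^bsub>M\<^esub> finprod M ?d ?A"
  proof (rule M.finprod_Un_disjoint)
    show "insert c ` ?A \<inter> ?A = {}" using c by blast
  qed (use fin G in \<open>auto intro!: atom_mem_carrier simp del: M_simps\<close>)
  also have "finprod M ?d (insert c ` ?A) = finprod M (\<lambda>U. ?d (insert c U)) ?A"
  proof (rule M.finprod_reindex)
    show "inj_on (insert c) ?A"
      using c by (auto simp: inj_on_def insert_ident)
  qed (use G in \<open>auto intro!: atom_mem_carrier simp del: M_simps\<close>)
  also have "\<dots> \<otimes>\<^bsub>M\<^esub> finprod M ?d ?A = finprod M (\<lambda>U. ?d (insert c U) \<otimes>\<^bsub>M\<^esub> ?d U) ?A"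
  proof (rule M.finprod_multf[symmetric])
    show "(\<lambda>U. ?d (insert c U)) \<in> ?A \<rightarrow> carrier M"
      by (rule funcsetI, rule atom_mem_carrier[OF G]) auto
  qed (use G in \<open>auto intro!: atom_mem_carrier simp del: M_simps\<close>)
  also have "\<dots> = weight F W"
    unfolding weight_def
  proof (rule M.finprod_cong'[OF refl])
    show "(\<lambda>U. atom U (F - U)) \<in> ?A \<rightarrow> carrier M"
      by (rule funcsetI, rule atom_mem_carrier[OF Fin]) auto
    fix U assume "U \<in> ?A"
    then have U: "U \<subseteq> F" "U \<in> Fpow T" "F - U \<in> Fpow T"
      using Fin finite_subset by (auto simp: Fpow_def)
    then have "insert c F - insert c U = F - U" "insert c F - U = insert c (F - U)"
      using c by auto
    then show "?d (insert c U) \<otimes>\<^bsub>M\<^esub> ?d U = atom U (F - U)"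
      using atom_split[OF U(2,3) c(1)] subsetD[OF U(1)] c(2) by fastforce
  qed
  finally show ?thesis .
qed

lemma weight_Un_support:
  assumes F: "supports F W" and "finite D" "D \<subseteq> T"
  shows "weight (F \<union> D) W = weight F W"
  using assms(2,3)
proof (induction D rule: finite_induct)
  case (insert c D)
  then have "F \<union> D \<in> Fpow T"
    using supports_Fpow[OF F] by (simp add: Fpow_def)
  then have "supports (F \<union> D) W"
    using supports_mono[OF F] by blast
  then have "weight (insert c (F \<union> D)) W = weight (F \<union> D) W"
    using weight_insert insert by (metis insert_absorb insert_subset)
  then show ?case using insert by simp
qed simp

text \<open>
  Two supports are compared through their union.
\<close>

lemma weight_eq:
  assumes F: "supports F W" and G: "supports G W"
  shows "weight F W = weight G W"
  using weight_Un_support[OF F, of G] weight_Un_support[OF G, of F] assms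
  by (simp add: supports_def Fpow_def Un_commute)

text \<open>
  The set of all points is supported by \<open>{}\<close>, where the sum has \<open>atom {} {}\<close> as its only term.
\<close>

lemma weight_UNIV: "weight F UNIV = Some \<one>" if "F \<in> Fpow T"
proof -
  have "weight F UNIV = weight {} UNIV"
    by (rule weight_eq) (use that in \<open>auto simp: supports_def Fpow_def\<close>)
  also have "\<dots> = Some \<one>"
    using one_closed zero_closed zero_oplus atom_empty_empty
    by (simp add: weight_def oplus_eq_commute[of \<one>])
  finally show ?thesis .
qed

text \<open>
  All sums that occur are defined because each is a summand of the total sum \<open>\<one>\<close>, the other summand
  being the weight of the complement.
\<close>

lemma weight_observable_map:
  assumes F: "supports F W"
  shows "weight F W = Some (observable_map W)" and "observable_map W \<in> E"
proof -
  have Fin: "F \<in> Fpow T" using F by (simp add: supports_def)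
  have "weight F W \<otimes>\<^bsub>M\<^esub> weight F (- W) = Some \<one>"
    using weight_Un[OF Fin, of W "- W"] weight_UNIV[OF Fin] by (simp add: Compl_partition)
  then have "weight F W \<noteq> None" by (intro notI) simp
  moreover have "weight F W \<in> carrier M"
    unfolding weight_def
    by (rule M.finprod_closed, rule funcsetI, rule atom_mem_carrier[OF Fin]) auto
  moreover have "weight (SOME F. supports F W) W = weight F W"
    using weight_eq F by (metis someI)
  ultimately show "weight F W = Some (observable_map W)" "observable_map W \<in> E"
    by (auto simp: observable_map_def)
qed

lemma observable_observable_map:
  "observable (inclusion_order cylinders) observable_map"
proof -
  have Fin: "{} \<in> Fpow T" by (simp add: Fpow_def)
  have "weight {} {} = Some \<zero>" by (simp add: weight_def)
  then have "observable_map {} = \<zero>" "observable_map UNIV = \<one>"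
    using weight_observable_map(1)[of "{}" "{}"] weight_observable_map(1)[of "{}" UNIV]
      weight_UNIV[OF Fin] Fin by (simp_all add: supports_def)
  moreover have "observable_map W \<oplus> observable_map X = Some (observable_map (W \<union> X))"
    if "W \<in> cylinders" "X \<in> cylinders" "W \<inter> X = {}" for W X
  proof -
    obtain F G where FG: "supports F W" "supports G X"
      using \<open>W \<in> cylinders\<close> \<open>X \<in> cylinders\<close> by (auto simp: cylinders_def)
    then have Fin: "F \<union> G \<in> Fpow T"
      by (intro Un_Fpow supports_Fpow)
    have supp: "supports (F \<union> G) W" "supports (F \<union> G) X"
      using supports_mono[OF FG(1) _ Fin] supports_mono[OF FG(2) _ Fin] by simp_all
    show ?thesis
      using weight_Un[OF Fin \<open>W \<inter> X = {}\<close>] supp supports_Un[OF supp]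
      by (simp add: weight_observable_map(1))
  qed
  moreover have "observable_map W \<in> E" if "W \<in> cylinders" for W
    using that weight_observable_map(2) by (auto simp: cylinders_def)
  ultimately show ?thesis
    using cyl.boolean_lattice_inclusion_order
    by (simp add: observable_def cyl.join_eq cyl.meet_eq cyl.inclusion_bottom cyl.inclusion_top)
qed

lemma observable_map_range: "T \<subseteq> observable_map ` cylinders"
proof
  fix c assume c: "c \<in> T"
  have supp: "supports {c} {x. c \<in> x}"
    using c by (simp add: supports_def Fpow_def)
  have "Pow {c} \<inter> {x. c \<in> x} = {{c}}" by auto
  moreover have "c \<in> E" using c T_subset by blast
  ultimately have "weight {c} {x. c \<in> x} = Some c"
    using atom_singleton_empty[OF c] zero_closed zero_oplus
    by (simp add: weight_def oplus_eq_commute[of c])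
  with weight_observable_map(1)[OF supp] have "observable_map {x. c \<in> x} = c" by simp
  moreover have "{x. c \<in> x} \<in> cylinders"
    using supp unfolding cylinders_def by blast
  ultimately show "c \<in> observable_map ` cylinders"
    by (metis imageI)
qed

end

text \<open>
  The points of the cylinders are subsets of \<open>'a\<close>, so the elements of the Boolean algebra
  have type \<open>'a set set\<close>.
\<close>

theorem theorem1:
  fixes E :: "'a set"
    and oplus :: "'a \<Rightarrow> 'a \<Rightarrow> 'a option"
    and zero one :: 'a
    and S :: "'a set"
  assumes "effect_algebra E oplus zero one"
    and "S \<subseteq> E"
    and "effect_algebra.admits_compatibility_support_mapping E oplus zero one (S \<union> {one})"
  shows "effect_algebra.coexistent E oplus zero one TYPE('a set set) S"
proof -
  interpret effect_algebra E oplus zero one by fact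
  obtain f where "compatibility_support_mapping E oplus zero one (S \<union> {one}) f"
    using assms(3) by (auto simp: admits_compatibility_support_mapping_def)
  then interpret compatibility_support_mapping E oplus zero one "S \<union> {one}" f .
  show ?thesis
    unfolding coexistent_def
  proof (intro conjI exI)
    show "S \<subseteq> observable_map ` carrier (inclusion_order cylinders)"
      using observable_map_range by simp
  qed (rule assms(2) observable_observable_map)+
qed

end
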